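(* Let $G$ be a finite, simple, connected graph of order $n$ with maximum degree $\Delta$, and let $P(G,x)$ be its chromatic polynomial. Then for every integer $k\geq 2$, \[ \frac{d^k}{dx^k}\Big(\ln\big[(-1)^n P(G,x)\big]\Big) < 0 \] holds for all real $x<0$ with $x\leq -6.66\,\Delta k$.
   Context: All graphs are finite, simple and connected. The chromatic polynomial $P(G,x)$ is the polynomial in $x$ which, for each positive integer $x$, equals the number of proper colorings $c:V(G)\to\{1,\dots,x\}$ (i.e. $c(u)\neq c(v)$ whenever $uv$ is an edge). For $x<0$ one has $(-1)^nP(G,x)>0$, so $\ln[(-1)^nP(G,x)]$ is defined for $x<0$. $\Delta$ denotes the maximum degree of $G$. *)

theory Defs
  imports
    "HOL-Analysis.Analysis"
    "HOL-Computational_Algebra.Polynomial"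
    "Graph_Theory.Digraph_Component"
begin

text \<open>
  Finite simple graphs are those of the locale \<^locale>\<open>graph\<close>: every undirected edge is
  a pair of opposite arcs, so the degree of a vertex is its out-degree. Both graph theory and
  topology provide a constant \<open>connected\<close>, hence the qualified name
  \<^const>\<open>Digraph_Component.connected\<close>; that notion includes that there is a vertex.
\<close>

definition max_degree :: "('a, 'b) pre_digraph \<Rightarrow> nat" where
  "max_degree G = Max (out_degree G ` verts G)"

text \<open>Colorings are extensional functions, so that each coloring of the vertices counts once.\<close>

definition proper_colorings :: "('a, 'b) pre_digraph \<Rightarrow> nat \<Rightarrow> ('a \<Rightarrow> nat) set" where
  "proper_colorings G m =
     {c \<in> verts G \<rightarrow>\<^sub>E {1..m}. \<forall>e\<in>arcs G. c (tail G e) \<noteq> c (head G e)}"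

definition chromatic_poly :: "('a, 'b) pre_digraph \<Rightarrow> real poly" where
  "chromatic_poly G =
     (THE p. \<forall>m::nat. m \<ge> 1 \<longrightarrow> poly p (real m) = real (card (proper_colorings G m)))"

text \<open>
  The description is well-defined: a coloring with exactly the set \<open>S\<close> of used colors can be
  relabeled to one using exactly \<open>{1..card S}\<close>, so the number of proper colorings is a fixed
  combination of the binomial coefficients \<open>m choose j\<close>, \<open>j \<le> n\<close>.
\<close>

lemma card_proper_colorings_image:
  assumes wf: "wf_digraph G" and fin: "finite (verts G)" and S: "S \<subseteq> {1..m}"
  shows "card {c \<in> proper_colorings G m. c ` verts G = S} =
         card {c \<in> proper_colorings G (card S). c ` verts G = {1..card S}}"
proof -
  interpret wf_digraph G by (fact wf)
  have "finite S" using S finite_subset by blast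
  then obtain h where h: "bij_betw h S {1..card S}"
    using finite_same_card_bij[of S "{1..card S}"] by auto
  define g where "g = inv_into S h"
  have g: "bij_betw g {1..card S} S"
    unfolding g_def using h by (rule bij_betw_inv_into)
  have hg: "\<And>y. y \<in> {1..card S} \<Longrightarrow> h (g y) = y" and gh: "\<And>x. x \<in> S \<Longrightarrow> g (h x) = x"
    unfolding g_def using h bij_betw_inv_into_left bij_betw_inv_into_right by metis+
  let ?A = "{c \<in> proper_colorings G m. c ` verts G = S}"
  let ?B = "{c \<in> proper_colorings G (card S). c ` verts G = {1..card S}}"
  have "bij_betw (\<lambda>c. restrict (h \<circ> c) (verts G)) ?A ?B"
  proof (rule bij_betw_byWitness[where f' = "\<lambda>c. restrict (g \<circ> c) (verts G)"])
    show "\<forall>c\<in>?A. restrict (g \<circ> restrict (h \<circ> c) (verts G)) (verts G) = c"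
    proof (intro ballI ext)
      fix c v assume c: "c \<in> ?A"
      show "restrict (g \<circ> restrict (h \<circ> c) (verts G)) (verts G) v = c v"
      proof (cases "v \<in> verts G")
        case True
        with c have "c v \<in> S" by blast
        with True show ?thesis by (simp add: gh)
      next
        case False
        have "c \<in> verts G \<rightarrow>\<^sub>E {1..m}"
          using c by (simp add: proper_colorings_def)
        from PiE_arb[OF this False] False show ?thesis by simp
      qed
    qed
    show "\<forall>c\<in>?B. restrict (h \<circ> restrict (g \<circ> c) (verts G)) (verts G) = c"
    proof (intro ballI ext)
      fix c v assume c: "c \<in> ?B"
      show "restrict (h \<circ> restrict (g \<circ> c) (verts G)) (verts G) v = c v"
      proof (cases "v \<in> verts G")
        case True
        with c have "c v \<in> {1..card S}" by blast
        with True show ?thesis by (simp add: hg del: atLeastAtMost_iff)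
      next
        case False
        have "c \<in> verts G \<rightarrow>\<^sub>E {1..card S}"
          using c by (simp add: proper_colorings_def)
        from PiE_arb[OF this False] False show ?thesis by simp
      qed
    qed
    show "(\<lambda>c. restrict (h \<circ> c) (verts G)) ` ?A \<subseteq> ?B"
    proof (intro image_subsetI)
      fix c assume c: "c \<in> ?A"
      have im: "restrict (h \<circ> c) (verts G) ` verts G = {1..card S}"
      proof -
        have "restrict (h \<circ> c) (verts G) ` verts G = h ` (c ` verts G)"
          by (auto simp: image_image)
        also have "\<dots> = {1..card S}" using c bij_betw_imp_surj_on[OF h] by simp
        finally show ?thesis .
      qed
      have "h (c (tail G e)) \<noteq> h (c (head G e))" if "e \<in> arcs G" for e
      proof
        assume *: "h (c (tail G e)) = h (c (head G e))"
        have "c (tail G e) \<in> S" "c (head G e) \<in> S" using c that by auto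
        with * have "c (tail G e) = c (head G e)" using gh by metis
        with c that show False by (auto simp: proper_colorings_def)
      qed
      moreover have "restrict (h \<circ> c) (verts G) \<in> verts G \<rightarrow>\<^sub>E {1..card S}"
        using im by (metis image_subset_iff_funcset order_refl PiE_def IntI restrict_extensional)
      ultimately show "restrict (h \<circ> c) (verts G) \<in> ?B"
        using im by (simp add: proper_colorings_def)
    qed
    show "(\<lambda>c. restrict (g \<circ> c) (verts G)) ` ?B \<subseteq> ?A"
    proof (intro image_subsetI)
      fix c assume c: "c \<in> ?B"
      have im: "restrict (g \<circ> c) (verts G) ` verts G = S"
      proof -
        have "restrict (g \<circ> c) (verts G) ` verts G = g ` (c ` verts G)"
          by (auto simp: image_image)
        also have "\<dots> = S" using c bij_betw_imp_surj_on[OF g] by simp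
        finally show ?thesis .
      qed
      have "g (c (tail G e)) \<noteq> g (c (head G e))" if "e \<in> arcs G" for e
      proof
        assume *: "g (c (tail G e)) = g (c (head G e))"
        have "c (tail G e) \<in> {1..card S}" "c (head G e) \<in> {1..card S}"
          using c that tail_in_verts head_in_verts by blast+
        with * have "c (tail G e) = c (head G e)" using hg by metis
        with c that show False by (auto simp: proper_colorings_def)
      qed
      moreover have "restrict (g \<circ> c) (verts G) \<in> verts G \<rightarrow>\<^sub>E {1..m}"
        using im S by (metis image_subset_iff_funcset PiE_def IntI restrict_extensional)
      ultimately show "restrict (g \<circ> c) (verts G) \<in> ?A"
        using im by (simp add: proper_colorings_def)
    qed
  qed
  then show ?thesis by (rule bij_betw_same_card)
qed

lemma card_proper_colorings_binomial:
  assumes wf: "wf_digraph G" and fin: "finite (verts G)"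
  shows "card (proper_colorings G m) =
    (\<Sum>j\<le>card (verts G). (m choose j) *
       card {c \<in> proper_colorings G j. c ` verts G = {1..j}})"
proof -
  define t where "t j = card {c \<in> proper_colorings G j. c ` verts G = {1..j}}" for j
  have finc: "finite (proper_colorings G m)"
    unfolding proper_colorings_def
    by (rule finite_subset[of _ "verts G \<rightarrow>\<^sub>E {1..m}"]) (auto intro: finite_PiE fin)
  have t0: "t j = 0" if "j > card (verts G)" for j
  proof -
    have "{c \<in> proper_colorings G j. c ` verts G = {1..j}} = {}"
    proof (intro equals0I)
      fix c assume "c \<in> {c \<in> proper_colorings G j. c ` verts G = {1..j}}"
      then have "card (c ` verts G) = j" by simp
      with card_image_le[OF fin, of c] that show False by simp
    qed
    then show ?thesis unfolding t_def by (metis card.empty)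
  qed
  have "proper_colorings G m =
      (\<Union>S\<in>Pow {1..m}. {c \<in> proper_colorings G m. c ` verts G = S})"
    by (auto simp: proper_colorings_def PiE_iff)
  then have "card (proper_colorings G m) =
      card (\<Union>S\<in>Pow {1..m}. {c \<in> proper_colorings G m. c ` verts G = S})"
    by simp
  also have "\<dots> = (\<Sum>S\<in>Pow {1..m}. card {c \<in> proper_colorings G m. c ` verts G = S})"
    by (rule card_UN_disjoint) (use finc in auto)
  also have "\<dots> = (\<Sum>S\<in>Pow {1..m}. t (card S))"
    unfolding t_def by (intro sum.cong refl card_proper_colorings_image wf fin) auto
  also have "\<dots> = (\<Sum>j\<le>m. \<Sum>S\<in>{S \<in> Pow {1..m}. card S = j}. t (card S))"
    by (rule sum.group[symmetric]) (auto dest: card_mono[rotated])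
  also have "\<dots> = (\<Sum>j\<le>m. (m choose j) * t j)"
  proof (rule sum.cong[OF refl])
    fix j
    have "(\<Sum>S\<in>{S \<in> Pow {1..m}. card S = j}. t (card S)) =
        card {S. S \<subseteq> {1..m} \<and> card S = j} * t j"
      by (simp add: Pow_def)
    also have "\<dots> = (m choose j) * t j"
      using n_subsets[of "{1..m}" j] by simp
    finally show "(\<Sum>S\<in>{S \<in> Pow {1..m}. card S = j}. t (card S)) = (m choose j) * t j" .
  qed
  also have "\<dots> = (\<Sum>j\<le>max m (card (verts G)). (m choose j) * t j)"
    by (rule sum.mono_neutral_left) (auto simp: binomial_eq_0)
  also have "\<dots> = (\<Sum>j\<le>card (verts G). (m choose j) * t j)"
    by (rule sum.mono_neutral_right) (auto simp: t0)
  finally show ?thesis unfolding t_def .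
qed

lemma chromatic_poly_ex1:
  assumes wf: "wf_digraph G" and fin: "finite (verts G)"
  shows "\<exists>!p::real poly. \<forall>m::nat. m \<ge> 1 \<longrightarrow>
           poly p (real m) = real (card (proper_colorings G m))"
proof (rule ex_ex1I)
  let ?t = "\<lambda>j. card {c \<in> proper_colorings G j. c ` verts G = {1..j}}"
  define p :: "real poly" where
    "p = (\<Sum>j\<le>card (verts G). smult (real (?t j) / fact j) (\<Prod>i = 0..<j. [:- real i, 1:]))"
  have "poly p (real m) = real (card (proper_colorings G m))" for m
  proof -
    have "poly p (real m) =
        (\<Sum>j\<le>card (verts G). real (?t j) * ((\<Prod>i = 0..<j. real m - real i) / fact j))"
      by (simp add: p_def poly_sum poly_prod)
    also have "\<dots> = (\<Sum>j\<le>card (verts G). real (?t j) * real (m choose j))"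
      by (simp add: binomial_gbinomial gbinomial_prod_rev)
    also have "\<dots> = real (card (proper_colorings G m))"
      unfolding card_proper_colorings_binomial[OF wf fin, of m] by (simp add: mult.commute)
    finally show ?thesis .
  qed
  then show "\<exists>p::real poly. \<forall>m::nat. m \<ge> 1 \<longrightarrow>
      poly p (real m) = real (card (proper_colorings G m))"
    by blast
next
  fix p q :: "real poly"
  assume p: "\<forall>m::nat. m \<ge> 1 \<longrightarrow> poly p (real m) = real (card (proper_colorings G m))"
    and q: "\<forall>m::nat. m \<ge> 1 \<longrightarrow> poly q (real m) = real (card (proper_colorings G m))"
  show "p = q"
  proof (rule ccontr)
    assume "p \<noteq> q"
    then have "p - q \<noteq> 0" by simp
    then have "finite {x. poly (p - q) x = 0}" by (rule poly_roots_finite)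
    moreover have "real ` {1..} \<subseteq> {x. poly (p - q) x = 0}" using p q by auto
    ultimately have "finite (real ` {1..})" by (rule finite_subset[rotated])
    then have "finite {1::nat..}" by (rule finite_imageD) (simp add: inj_on_def)
    then show False by (simp add: infinite_Ici)
  qed
qed

lemma poly_chromatic_poly:
  assumes "wf_digraph G" and "finite (verts G)" and "m \<ge> 1"
  shows "poly (chromatic_poly G) (real m) = real (card (proper_colorings G m))"
  using theI'[OF chromatic_poly_ex1[OF assms(1,2)]] assms(3)
  unfolding chromatic_poly_def by blast

end

theory Submission
  imports Defs "HOL-Computational_Algebra.Fundamental_Theorem_Algebra"
begin

text \<open>
  With \<open>r\<^sub>1, \<dots>, r\<^sub>m\<close> the complex roots of \<open>P(G, \<cdot>)\<close>, the \<open>k\<close>-th derivative of \<open>ln \<bar>P(G, x)\<bar>\<close> is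
  \<open>- (k - 1)! \<Sum> Re (r\<^sub>i - x)\<^sup>-\<^sup>k\<close>. If all roots lie in the disc of radius \<open>7.5 \<Delta>\<close>, then for
  \<open>x \<le> - 6.66 \<Delta> k\<close> the argument of each \<open>r\<^sub>i - x\<close> is less than \<open>\<pi> / (2 k)\<close>, so every summand is positive.

  The bound on the roots comes from the expansion \<open>P(G[U], x) = \<Sum> \<Prod> x w(C)\<close> over the partitions of \<open>U\<close>
  into blocks \<open>C\<close>, where \<open>w\<close> is the logarithm, for subset convolution, of the indicator of
  independent sets. Removing a vertex \<open>u\<close> gives \<open>w(S \<union> {u}) = \<Sum> \<Prod> (- w(C))\<close> over the partitions of \<open>S\<close>
  all of whose blocks meet the neighbourhood of \<open>u\<close>, hence inductively
  \<open>\<Sum>\<^sub>S \<bar>w(S \<union> {u})\<bar> z\<^bsup>\<bar>S\<bar>\<^esup> \<le> exp (\<Delta> z b) \<le> b\<close>. Taking \<open>b = 3/2\<close> and \<open>z = 2 / \<bar>x\<bar>\<close>, induction on \<open>U\<close>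
  shows that \<open>P(G[U \<union> {u}], x) / (x P(G[U], x))\<close> is within \<open>1/2\<close> of \<open>1\<close> whenever \<open>\<bar>x\<bar> \<ge> 7.5 \<Delta>\<close>.
\<close>

section \<open>The exponential for subset convolution\<close>

text \<open>\<open>setexp f U\<close> is the sum over all partitions of \<open>U\<close> of the product of \<open>f\<close> over the blocks,
  that is, the exponential of \<open>f\<close> with respect to subset convolution. It is computed by splitting
  off the block of one vertex; by \<open>setexp_rec\<close> the choice of this vertex is irrelevant.
  Infinite sets get the junk value 1.\<close>

function setexp :: "('a set \<Rightarrow> 'r::comm_ring_1) \<Rightarrow> 'a set \<Rightarrow> 'r" where
  "setexp f U = (if infinite U \<or> U = {} then 1
     else \<Sum>S | S \<subseteq> U \<and> (SOME u. u \<in> U) \<in> S. f S * setexp f (U - S))"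
  by pat_completeness auto
termination
proof (relation "Wellfounded.measure (\<lambda>(f, U). card U)", goal_cases)
  case (2 f U S)
  then have "finite U" "S \<subseteq> U" "S \<noteq> {}" by auto
  then have "card (U - S) < card U"
    by (intro psubset_card_mono) auto
  then show ?case by simp
qed simp

declare setexp.simps [simp del]

lemma setexp_empty [simp]: "setexp f {} = 1"
  by (subst setexp.simps) simp

lemma setexp_some:
  assumes "finite U" "U \<noteq> {}"
  shows "setexp f U = (\<Sum>S | S \<subseteq> U \<and> (SOME u. u \<in> U) \<in> S. f S * setexp f (U - S))"
  using assms by (subst setexp.simps) simp

lemma card_Diff_less:
  assumes "finite U" "S \<subseteq> U" "u \<in> S"
  shows "card (U - S) < card U"
  using assms by (intro psubset_card_mono) auto

lemma setexp_rec:
  assumes "finite U" "u \<in> U"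
  shows "setexp f U = (\<Sum>S | S \<subseteq> U \<and> u \<in> S. f S * setexp f (U - S))"
  using assms
proof (induction "card U" arbitrary: U u rule: less_induct)
  case less
  define v where "v = (SOME u. u \<in> U)"
  have v: "v \<in> U" unfolding v_def using less.prems(2) by (rule someI)
  have fin: "finite {S. S \<subseteq> U \<and> P S}" for P
    using less.prems(1) by simp
  \<comment> \<open>Expanding a second time at the other vertex makes the sum symmetric in the two vertices.\<close>
  have expand: "(\<Sum>S | S \<subseteq> U \<and> a \<in> S. f S * setexp f (U - S)) =
      (\<Sum>S | S \<subseteq> U \<and> a \<in> S \<and> b \<in> S. f S * setexp f (U - S)) +
      (\<Sum>(S, T) | S \<subseteq> U \<and> T \<subseteq> U \<and> S \<inter> T = {} \<and> a \<in> S \<and> b \<in> T.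
         f S * f T * setexp f (U - (S \<union> T)))"
    if ab: "a \<in> U" "b \<in> U" for a b
  proof -
    have "(\<Sum>S | S \<subseteq> U \<and> a \<in> S. f S * setexp f (U - S)) =
      (\<Sum>S | S \<subseteq> U \<and> a \<in> S \<and> b \<in> S. f S * setexp f (U - S)) +
      (\<Sum>S | S \<subseteq> U \<and> a \<in> S \<and> b \<notin> S. f S * setexp f (U - S))"
      by (subst sum.union_disjoint [symmetric]) (auto simp: fin intro!: sum.cong)
    also have "(\<Sum>S | S \<subseteq> U \<and> a \<in> S \<and> b \<notin> S. f S * setexp f (U - S)) =
       (\<Sum>S | S \<subseteq> U \<and> a \<in> S \<and> b \<notin> S. \<Sum>T | T \<subseteq> U - S \<and> b \<in> T. 
         f S * f T * setexp f (U - (S \<union> T)))"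
    proof (intro sum.cong refl)
      fix S assume "S \<in> {S. S \<subseteq> U \<and> a \<in> S \<and> b \<notin> S}"
      then have S: "S \<subseteq> U" "a \<in> S" "b \<notin> S" by auto
      have "setexp f (U - S) = (\<Sum>T | T \<subseteq> U - S \<and> b \<in> T. f T * setexp f (U - S - T))"
        using S ab less.prems(1) card_Diff_less[of U S a] by (intro less.hyps) auto
      then show "f S * setexp f (U - S) =
          (\<Sum>T | T \<subseteq> U - S \<and> b \<in> T. f S * f T * setexp f (U - (S \<union> T)))"
        by (simp add: sum_distrib_left mult.assoc Diff_eq Int_assoc)
    qed
    also have "\<dots> = (\<Sum>(S, T)\<in>(SIGMA S:{S. S \<subseteq> U \<and> a \<in> S \<and> b \<notin> S}. {T. T \<subseteq> U - S \<and> b \<in> T}). 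
         f S * f T * setexp f (U - (S \<union> T)))"
      using less.prems(1) by (intro sum.Sigma) auto
    also have "(SIGMA S:{S. S \<subseteq> U \<and> a \<in> S \<and> b \<notin> S}. {T. T \<subseteq> U - S \<and> b \<in> T}) =
       {(S, T). S \<subseteq> U \<and> T \<subseteq> U \<and> S \<inter> T = {} \<and> a \<in> S \<and> b \<in> T}"
      by auto
    finally show ?thesis .
  qed
  have swap: "(\<Sum>(S, T) | S \<subseteq> U \<and> T \<subseteq> U \<and> S \<inter> T = {} \<and> v \<in> S \<and> u \<in> T.
         f S * f T * setexp f (U - (S \<union> T))) =
       (\<Sum>(S, T) | S \<subseteq> U \<and> T \<subseteq> U \<and> S \<inter> T = {} \<and> u \<in> S \<and> v \<in> T.
         f S * f T * setexp f (U - (S \<union> T)))"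
    by (rule sum.reindex_bij_witness[where i = prod.swap and j = prod.swap])
       (auto simp: Un_commute mult.commute)
  have "setexp f U = (\<Sum>S | S \<subseteq> U \<and> v \<in> S. f S * setexp f (U - S))"
    using less.prems unfolding v_def by (intro setexp_some) auto
  also have "\<dots> = (\<Sum>S | S \<subseteq> U \<and> u \<in> S. f S * setexp f (U - S))"
    unfolding expand[OF v less.prems(2)] expand[OF less.prems(2) v] swap
    by (simp add: conj_commute)
  finally show ?case .
qed

lemma setexp_rec_insert:
  assumes "finite U" "u \<notin> U"
  shows "setexp f (insert u U) = (\<Sum>S\<in>Pow U. f (insert u S) * setexp f (U - S))"
proof -
  have "setexp f (insert u U) =
      (\<Sum>S | S \<subseteq> insert u U \<and> u \<in> S. f S * setexp f (insert u U - S))"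
    using assms by (intro setexp_rec) auto
  also have "\<dots> = (\<Sum>S\<in>Pow U. f (insert u S) * setexp f (U - S))"
    using assms
    by (intro sum.reindex_bij_witness[where i = "insert u" and j = "\<lambda>S. S - {u}"])
       (auto simp: insert_absorb intro!: arg_cong2[where f = "(*)"] arg_cong[where f = "setexp f"])
  finally show ?thesis .
qed

text \<open>Splitting off the block of \<open>u\<close> leaves \<open>U - S\<close> for every
  \<open>S \<subseteq> U\<close>, so the induction hypothesis must cover all subsets of
  \<open>U\<close> and not only \<open>U\<close> itself.\<close>

lemma finite_insert_induct [consumes 1, case_names empty insert]:
  assumes "finite U" "P {}"
    and "\<And>u U. finite U \<Longrightarrow> u \<notin> U \<Longrightarrow> (\<And>T. T \<subseteq> U \<Longrightarrow> P T) \<Longrightarrow> P (insert u U)"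
  shows "P U"
  using assms(1)
proof (induction rule: finite_psubset_induct)
  case (psubset U)
  show ?case
  proof (cases "U = {}")
    case False
    then obtain u where u: "u \<in> U" by auto
    have "P (insert u (U - {u}))"
      using psubset u by (intro assms(3)) auto
    with u show ?thesis by (simp add: insert_absorb)
  qed (use assms(2) in simp)
qed

lemma sum_Pow_insert:
  assumes "finite V" "v \<notin> V"
  shows "sum h (Pow (insert v V)) = sum h (Pow V) + (\<Sum>S\<in>Pow V. h (insert v S))"
proof -
  have inj: "inj_on (insert v) (Pow V)"
    using assms by (auto simp: inj_on_def)
  show ?thesis
    unfolding Pow_insert using assms
    by (subst sum.union_disjoint) (auto simp: sum.reindex[OF inj])
qed

text \<open>Expanding the product over the blocks, each block takes its weight from \<open>f\<close>
  or from \<open>g\<close>; \<open>T\<close> is the union of the blocks that choose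
  \<open>f\<close>.\<close>

lemma setexp_add:
  assumes "finite U"
  shows "setexp (\<lambda>S. f S + g S) U = (\<Sum>T\<in>Pow U. setexp f T * setexp g (U - T))"
  using assms
proof (induction rule: finite_insert_induct)
  case (insert u U)
  let ?h = "\<lambda>S. f S + g S"
  have finP: "finite (Pow S)" if "S \<subseteq> U" for S
    using that insert.hyps finite_subset by auto
  have diff: "insert u U - insert u T = U - T" for T using insert.hyps by auto
  have "(\<Sum>T\<in>Pow (insert u U). setexp f T * setexp g (insert u U - T)) =
      (\<Sum>T\<in>Pow U. setexp f T * setexp g (insert u U - T)) +
      (\<Sum>T\<in>Pow U. setexp f (insert u T) * setexp g (U - T))"
    unfolding sum_Pow_insert[OF insert.hyps] diff ..
  \<comment> \<open>Here \<open>u\<close> lies outside \<open>T\<close>, so its block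
    \<open>insert u S\<close> carries the weight \<open>g\<close>.\<close>
  also have "(\<Sum>T\<in>Pow U. setexp f T * setexp g (insert u U - T)) =
      (\<Sum>T\<in>Pow U. \<Sum>S\<in>Pow (U - T). g (insert u S) * (setexp f T * setexp g (U - S - T)))"
  proof (intro sum.cong refl)
    fix T assume T: "T \<in> Pow U"
    then have eq: "insert u U - T = insert u (U - T)" using insert.hyps by auto
    have "setexp g (insert u U - T) = (\<Sum>S\<in>Pow (U - T). g (insert u S) * setexp g (U - T - S))"
      unfolding eq using insert.hyps by (intro setexp_rec_insert) auto
    then show "setexp f T * setexp g (insert u U - T) =
      (\<Sum>S\<in>Pow (U - T). g (insert u S) * (setexp f T * setexp g (U - S - T)))"
      by (simp add: sum_distrib_left mult_ac Diff_eq Int_assoc)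
         (simp add: Int_commute Int_left_commute)
  qed
  \<comment> \<open>With the block of \<open>u\<close> fixed first, the inner sum is the induction
    hypothesis for \<open>U - S\<close>.\<close>
  also have "\<dots> = (\<Sum>S\<in>Pow U. \<Sum>T\<in>Pow (U - S). g (insert u S) * (setexp f T * setexp g (U - S - T)))"
    unfolding sum.Sigma[OF finP[OF order.refl] ballI[OF finP[OF Diff_subset]]]
    by (rule sum.reindex_bij_witness[where i = prod.swap and j = prod.swap]) auto
  also have "\<dots> = (\<Sum>S\<in>Pow U. g (insert u S) * setexp ?h (U - S))"
    by (intro sum.cong refl) (simp add: insert.IH sum_distrib_left)
  also have "(\<Sum>T\<in>Pow U. setexp f (insert u T) * setexp g (U - T)) =
      (\<Sum>T\<in>Pow U. \<Sum>S\<in>Pow T. f (insert u S) * (setexp f (T - S) * setexp g (U - T)))"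
  proof (intro sum.cong refl)
    fix T assume "T \<in> Pow U"
    then have T: "finite T" "u \<notin> T" using insert.hyps finite_subset by auto
    show "setexp f (insert u T) * setexp g (U - T) = 
        (\<Sum>S\<in>Pow T. f (insert u S) * (setexp f (T - S) * setexp g (U - T)))"
      unfolding setexp_rec_insert[OF T] by (simp add: sum_distrib_right mult.assoc)
  qed
  also have "\<dots> = (\<Sum>(T, S)\<in>(SIGMA T:Pow U. Pow T).
      f (insert u S) * (setexp f (T - S) * setexp g (U - T)))"
    using finP by (intro sum.Sigma) auto
  \<comment> \<open>In the terms where \<open>u\<close> belongs to the \<open>f\<close> part,
    \<open>T\<close> now stands for what remains of that part after the block of \<open>u\<close> is
    removed.\<close>
  also have "\<dots> = (\<Sum>(S, T)\<in>(SIGMA S:Pow U. Pow (U - S)).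
      f (insert u S) * (setexp f T * setexp g (U - S - T)))"
    by (rule sum.reindex_bij_witness[where j = "\<lambda>(T, S). (S, T - S)" and i = "\<lambda>(S, T). (S \<union> T, S)"])
       (auto intro!: arg_cong2[where f = "(*)"] arg_cong[where f = "setexp f"] arg_cong[where f = "setexp g"])
  also have "\<dots> = (\<Sum>S\<in>Pow U. \<Sum>T\<in>Pow (U - S). f (insert u S) * (setexp f T * setexp g (U - S - T)))"
    using finP by (intro sum.Sigma[symmetric]) auto
  also have "\<dots> = (\<Sum>S\<in>Pow U. f (insert u S) * setexp ?h (U - S))"
    by (intro sum.cong refl) (simp add: insert.IH sum_distrib_left)
  also have "(\<Sum>S\<in>Pow U. g (insert u S) * setexp ?h (U - S)) + \<dots> = setexp ?h (insert u U)"
    unfolding setexp_rec_insert[OF insert.hyps] by (simp add: sum.distrib distrib_right)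
  finally show ?case ..
qed simp

lemma setexp_zero:
  assumes "finite U"
  shows "setexp (\<lambda>_. 0) U = (if U = {} then 1 else 0)"
proof (cases "U = {}")
  case False
  then obtain u where "u \<in> U" by auto
  with assms False show ?thesis by (simp add: setexp_rec)
qed simp

text \<open>Removing the blocks that meet \<open>N\<close> multiplies the exponential by the character
  \<open>U \<mapsto> [U \<inter> N = {}]\<close>, because this character is multiplicative for disjoint unions.\<close>

lemma setexp_avoiding:
  assumes "finite U"
  shows "setexp (\<lambda>S. if S \<inter> N = {} then f S else 0) U = (if U \<inter> N = {} then setexp f U else 0)"
  using assms
proof (induction rule: finite_insert_induct)
  case (insert u U)
  have "(if insert u S \<inter> N = {} then f (insert u S) else 0) *
        setexp (\<lambda>S. if S \<inter> N = {} then f S else 0) (U - S) =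
      (if insert u U \<inter> N = {} then f (insert u S) * setexp f (U - S) else 0)"
    if "S \<in> Pow U" for S
  proof -
    have "insert u U \<inter> N = {} \<longleftrightarrow> insert u S \<inter> N = {} \<and> (U - S) \<inter> N = {}"
      using that by auto
    then show ?thesis by (simp add: insert.IH)
  qed
  then show ?case
    unfolding setexp_rec_insert[OF insert.hyps] by simp
qed simp

text \<open>\<open>setexp f U\<close> is a polynomial expression in the values of \<open>f\<close>.
  This serves both for evaluating polynomials and for embedding the reals into the complex
  numbers.\<close>

lemma setexp_homomorphism:
  assumes "finite U"
    and "h 1 = 1" "\<And>a b. h (a * b) = h a * h b" "\<And>a b. h (a + b) = h a + h b" "h 0 = 0"
  shows "h (setexp f U) = setexp (\<lambda>S. h (f S)) U"
  using assms(1)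
proof (induction rule: finite_insert_induct)
  case (insert u U)
  have sum: "h (sum k A) = (\<Sum>x\<in>A. h (k x))" for k and A :: "'a set set"
    by (induction A rule: infinite_finite_induct) (simp_all add: assms)
  show ?case
    unfolding setexp_rec_insert[OF insert.hyps] sum by (simp add: assms insert.IH)
qed (simp add: assms)

text \<open>The block sizes of a partition add up to \<open>card U\<close>, so the powers of
  \<open>z\<close> distribute over the blocks.\<close>

lemma setexp_scale:
  assumes "finite U"
  shows "z ^ card U * setexp f U = setexp (\<lambda>S. z ^ card S * f S) U"
  using assms
proof (induction rule: finite_insert_induct)
  case (insert u U)
  have "z ^ card (insert u U) * (f (insert u S) * setexp f (U - S)) =
      z ^ card (insert u S) * f (insert u S) * setexp (\<lambda>S. z ^ card S * f S) (U - S)" 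
    if "S \<in> Pow U" for S
  proof -
    have S: "finite S" "u \<notin> S" "card S \<le> card U"
      using that insert.hyps by (auto intro: finite_subset card_mono)
    then have "card (insert u U) = card (insert u S) + card (U - S)"
      using that insert.hyps by (simp add: card_Diff_subset)
    then show ?thesis
      by (subst insert.IH[symmetric]) (auto simp: power_add)
  qed
  then show ?case
    unfolding setexp_rec_insert[OF insert.hyps] sum_distrib_left by (intro sum.cong) auto
qed simp

lemma setexp_nonneg:
  fixes f :: "'a set \<Rightarrow> real"
  assumes "finite U" "\<And>S. f S \<ge> 0"
  shows "setexp f U \<ge> 0"
  using assms(1)
  by (induction rule: finite_insert_induct)
     (auto simp: setexp_rec_insert intro!: sum_nonneg mult_nonneg_nonneg assms(2))

lemma abs_setexp_le:
  fixes f :: "'a set \<Rightarrow> real"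
  assumes "finite U"
  shows "\<bar>setexp f U\<bar> \<le> setexp (\<lambda>S. \<bar>f S\<bar>) U"
  using assms
proof (induction rule: finite_insert_induct)
  case (insert u U)
  have "\<bar>setexp f (insert u U)\<bar> \<le> (\<Sum>S\<in>Pow U. \<bar>f (insert u S) * setexp f (U - S)\<bar>)"
    unfolding setexp_rec_insert[OF insert.hyps] by (rule sum_abs)
  also have "\<dots> \<le> (\<Sum>S\<in>Pow U. \<bar>f (insert u S)\<bar> * setexp (\<lambda>S. \<bar>f S\<bar>) (U - S))"
    by (intro sum_mono) (auto simp: abs_mult insert.IH intro!: mult_left_mono)
  finally show ?case
    unfolding setexp_rec_insert[OF insert.hyps] .
qed simp

text \<open>The left side sums over all families of disjoint nonempty blocks in \<open>V\<close>.
  Giving up disjointness bounds it by the product of all \<open>1 + g C\<close>. In the induction,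
  this means enlarging \<open>V - C\<close> to \<open>V\<close> in the terms where \<open>v\<close>
  has the block \<open>insert v C\<close>.\<close>

lemma sum_setexp_le_exp:
  fixes g :: "'a set \<Rightarrow> real"
  assumes "finite V" and g: "\<And>S. g S \<ge> 0"
  shows "(\<Sum>S\<in>Pow V. setexp g S) \<le> exp (\<Sum>C\<in>Pow V - {{}}. g C)"
  using assms(1)
proof (induction rule: finite_induct)
  case (insert v V)
  have finP: "finite (Pow S)" "finite S" if "S \<subseteq> V" for S
    using that insert.hyps finite_subset by auto
  have nn: "setexp g S \<ge> 0" if "S \<subseteq> V" for S
    by (rule setexp_nonneg) (auto simp: g finP that)
  let ?F = "\<Sum>S\<in>Pow V. setexp g S"
  have "(\<Sum>S\<in>Pow V. setexp g (insert v S)) =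
      (\<Sum>S\<in>Pow V. \<Sum>C\<in>Pow S. g (insert v C) * setexp g (S - C))"
    using insert.hyps finP by (intro sum.cong refl setexp_rec_insert) auto
  also have "\<dots> = (\<Sum>(S, C)\<in>(SIGMA S:Pow V. Pow S). g (insert v C) * setexp g (S - C))"
    using finP by (intro sum.Sigma) auto
  also have "\<dots> = (\<Sum>(C, S)\<in>(SIGMA C:Pow V. Pow (V - C)). g (insert v C) * setexp g S)"
    by (rule sum.reindex_bij_witness[where j = "\<lambda>(T, S). (S, T - S)" and i = "\<lambda>(S, T). (S \<union> T, S)"])
       (auto intro!: arg_cong2[where f = "(*)"] arg_cong[where f = "setexp g"])
  also have "\<dots> = (\<Sum>C\<in>Pow V. g (insert v C) * (\<Sum>S\<in>Pow (V - C). setexp g S))"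
    unfolding sum_distrib_left using finP by (intro sum.Sigma[symmetric]) auto
  also have "\<dots> \<le> (\<Sum>C\<in>Pow V. g (insert v C) * ?F)"
    using finP(1)[OF order.refl] by (intro sum_mono mult_left_mono sum_mono2 g nn) auto
  also have "\<dots> = ?F * (\<Sum>C\<in>Pow V. g (insert v C))"
    by (simp add: sum_distrib_left mult.commute)
  finally have "(\<Sum>S\<in>Pow (insert v V). setexp g S) \<le> ?F * (1 + (\<Sum>C\<in>Pow V. g (insert v C)))"
    unfolding sum_Pow_insert[OF insert.hyps] by (simp add: distrib_left)
  also have "\<dots> \<le> exp (\<Sum>C\<in>Pow V - {{}}. g C) * exp (\<Sum>C\<in>Pow V. g (insert v C))"
    using insert.IH nn by (intro mult_mono exp_ge_add_one_self) (auto intro!: add_nonneg_nonneg sum_nonneg g)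
  also have "\<dots> = exp (\<Sum>C\<in>Pow (insert v V) - {{}}. g C)"
  proof -
    have "sum g (Pow (insert v V) - {{}}) = sum g (Pow (insert v V)) - g {}"
         "sum g (Pow V - {{}}) = sum g (Pow V) - g {}"
      using insert.hyps by (auto simp: sum_diff1)
    then show ?thesis by (simp add: sum_Pow_insert[OF insert.hyps] exp_add[symmetric])
  qed
  finally show ?case .
qed simp

section \<open>The logarithm for subset convolution\<close>

function setlog :: "('a set \<Rightarrow> 'r::comm_ring_1) \<Rightarrow> 'a set \<Rightarrow> 'r" where
  "setlog I U = (if infinite U then 0
     else I U - (\<Sum>S | S \<subset> U \<and> (SOME u. u \<in> U) \<in> S. setlog I S * I (U - S)))"
  by pat_completeness auto
termination
  by (relation "Wellfounded.measure (\<lambda>(I, U). card U)") (auto intro: psubset_card_mono)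

declare setlog.simps [simp del]

text \<open>The recursion for \<open>setlog\<close> is the one for \<open>setexp\<close> solved for
  the term \<open>S = U\<close>, whose cofactor is \<open>setexp (setlog I) {} = 1\<close>.\<close>

lemma setexp_setlog:
  assumes "finite U" "I {} = 1"
  shows "setexp (setlog I) U = I U"
  using assms(1)
proof (induction rule: finite_psubset_induct)
  case (psubset U)
  show ?case
  proof (cases "U = {}")
    case False
    define u where "u = (SOME u. u \<in> U)"
    have u: "u \<in> U" unfolding u_def using False by (simp add: some_in_eq)
    have "{S. S \<subseteq> U \<and> u \<in> S} = insert U {S. S \<subset> U \<and> u \<in> S}"
      using u by auto
    moreover have "finite {S. S \<subset> U \<and> u \<in> S}"
      using psubset.hyps(1) by (auto intro: finite_subset[of _ "Pow U"])
    ultimately have "setexp (setlog I) U = setlog I U +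
        (\<Sum>S | S \<subset> U \<and> u \<in> S. setlog I S * setexp (setlog I) (U - S))"
      using setexp_rec[OF psubset.hyps(1) u, of "setlog I"] by simp
    also have "(\<Sum>S | S \<subset> U \<and> u \<in> S. setlog I S * setexp (setlog I) (U - S)) =
        (\<Sum>S | S \<subset> U \<and> u \<in> S. setlog I S * I (U - S))"
      by (intro sum.cong refl) (subst psubset.IH, auto)
    also have "setlog I U = I U - \<dots>"
      using psubset.hyps(1) unfolding u_def by (subst setlog.simps) simp
    finally show ?thesis by simp
  qed (simp add: assms)
qed

section \<open>Independent sets, colorings and the Ursell function\<close>

definition indep :: "('a \<Rightarrow> 'a \<Rightarrow> bool) \<Rightarrow> 'a set \<Rightarrow> real" where
  "indep E S = (if \<exists>a\<in>S. \<exists>b\<in>S. E a b then 0 else 1)"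

text \<open>The Ursell function of the hard-core interaction: \<open>ursell E S\<close> is the sum of
  \<open>(-1)\<close> to the number of edges over all connected spanning subgraphs of the graph induced on \<open>S\<close>.\<close>

definition ursell :: "('a \<Rightarrow> 'a \<Rightarrow> bool) \<Rightarrow> 'a set \<Rightarrow> real" where
  "ursell E = setlog (indep E)"

lemma setexp_ursell:
  assumes "finite U"
  shows "setexp (ursell E) U = indep E U"
  unfolding ursell_def using assms by (rule setexp_setlog) (simp add: indep_def)

lemma ursell_singleton:
  assumes "\<not> E u u"
  shows "ursell E {u} = 1"
proof -
  have "setexp (ursell E) {u} = ursell E {u}"
    by (subst setexp_rec_insert) auto
  then show ?thesis using assms by (simp add: setexp_ursell indep_def)
qed

lemma ursell_insert:
  assumes E: "symp E" "irreflp E" and "finite U" "u \<notin> U"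
  shows "ursell E (insert u U) = setexp (\<lambda>C. if C \<inter> {v. E u v} = {} then 0 else - ursell E C) U"
  using assms(3,4)
proof (induction rule: finite_psubset_induct)
  case (psubset U)
  \<comment> \<open>Both sides have the same convolution with \<open>indep E\<close>, and \<open>indep E {} = 1\<close> makes this cancellable.\<close>
  define g where "g = (\<lambda>C. if C \<inter> {v. E u v} = {} then 0 else - ursell E C)"
  have "(\<Sum>S\<in>Pow U. setexp g S * indep E (U - S)) = setexp (\<lambda>C. g C + ursell E C) U"
    using psubset.hyps
    by (subst setexp_add) (auto simp: setexp_ursell)
  \<comment> \<open>Adding \<open>g\<close> to \<open>ursell E\<close> deletes exactly the blocks
    that meet the neighbourhood of \<open>u\<close>.\<close>
  also have "(\<lambda>C. g C + ursell E C) = (\<lambda>C. if C \<inter> {v. E u v} = {} then ursell E C else 0)"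
    by (auto simp: g_def)
  also have "setexp \<dots> U = (if U \<inter> {v. E u v} = {} then indep E U else 0)"
    using psubset.hyps by (simp add: setexp_avoiding setexp_ursell)
  also have "\<dots> = indep E (insert u U)"
    using E by (auto simp: indep_def dest: sympD irreflpD)
  also have "\<dots> = (\<Sum>S\<in>Pow U. ursell E (insert u S) * indep E (U - S))"
    using psubset.hyps psubset.prems
    by (subst setexp_ursell[symmetric]) (auto simp: setexp_rec_insert setexp_ursell intro!: sum.cong)
  finally have eq: "(\<Sum>S\<in>Pow U. setexp g S * indep E (U - S)) =
      (\<Sum>S\<in>Pow U. ursell E (insert u S) * indep E (U - S))" .
  have split: "sum h (Pow U) = h U + sum h (Pow U - {U})" for h :: "_ \<Rightarrow> real"
    using psubset.hyps by (intro sum.remove) auto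
  have "(\<Sum>S\<in>Pow U - {U}. setexp g S * indep E (U - S)) =
      (\<Sum>S\<in>Pow U - {U}. ursell E (insert u S) * indep E (U - S))"
    using psubset.prems unfolding g_def
    by (intro sum.cong refl arg_cong2[where f = "(*)"] psubset.IH[symmetric]) auto
  with eq have "setexp g U = ursell E (insert u U)"
    by (simp add: split indep_def)
  then show ?case by (simp add: g_def)
qed

section \<open>Counting colorings by the exponential\<close>

text \<open>Arbitrary vertex sets are allowed because removing a color class leaves a coloring of an
  induced subgraph.\<close>

definition colorings_on :: "('a \<Rightarrow> 'a \<Rightarrow> bool) \<Rightarrow> 'a set \<Rightarrow> nat \<Rightarrow> ('a \<Rightarrow> nat) set" where
  "colorings_on E U m = {c \<in> U \<rightarrow>\<^sub>E {1..m}. \<forall>a\<in>U. \<forall>b\<in>U. E a b \<longrightarrow> c a \<noteq> c b}"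

lemma finite_colorings_on: "finite U \<Longrightarrow> finite (colorings_on E U m)"
  unfolding colorings_on_def
  by (rule finite_subset[of _ "U \<rightarrow>\<^sub>E {1..m}"]) (auto intro: finite_PiE)

text \<open>The vertices of the last color \<open>Suc m\<close> form \<open>U - T\<close>, which has
  to be independent; the coloring of \<open>T\<close> by the other colors is then arbitrary.\<close>

lemma card_colorings_on_last_class:
  assumes "T \<subseteq> U"
  shows "real (card {c \<in> colorings_on E U (Suc m). {v \<in> U. c v \<le> m} = T}) =
    real (card (colorings_on E T m)) * indep E (U - T)"
proof (cases "\<exists>a\<in>U - T. \<exists>b\<in>U - T. E a b")
  case True
  then obtain a b where ab: "a \<in> U - T" "b \<in> U - T" "E a b" by auto
  have "{c \<in> colorings_on E U (Suc m). {v \<in> U. c v \<le> m} = T} = {}"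
  proof (intro equals0I)
    fix c assume c: "c \<in> {c \<in> colorings_on E U (Suc m). {v \<in> U. c v \<le> m} = T}"
    have "c a = Suc m" "c b = Suc m"
      using c ab by (force simp: colorings_on_def PiE_iff)+
    moreover have "c a \<noteq> c b" using c ab by (auto simp only: colorings_on_def)
    ultimately show False by simp
  qed
  with True show ?thesis by (simp only: card.empty) (simp add: indep_def)
next
  case False
  have "bij_betw (\<lambda>c. restrict c T)
      {c \<in> colorings_on E U (Suc m). {v \<in> U. c v \<le> m} = T} (colorings_on E T m)"
  proof (rule bij_betw_byWitness[where f' = "\<lambda>c v. if v \<in> U - T then Suc m else c v"])
    show "\<forall>c\<in>{c \<in> colorings_on E U (Suc m). {v \<in> U. c v \<le> m} = T}.
        (\<lambda>v. if v \<in> U - T then Suc m else restrict c T v) = c"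
    proof (intro ballI ext)
      fix c v assume c: "c \<in> {c \<in> colorings_on E U (Suc m). {v \<in> U. c v \<le> m} = T}"
      have "c v = Suc m" if "v \<in> U - T"
        using c that by (force simp: colorings_on_def PiE_iff)
      moreover have "c v = undefined" if "v \<notin> U"
        using c that by (auto simp: colorings_on_def PiE_iff extensional_def)
      ultimately show "(if v \<in> U - T then Suc m else restrict c T v) = c v"
        using assms by auto
    qed
    show "\<forall>c\<in>colorings_on E T m. restrict (\<lambda>v. if v \<in> U - T then Suc m else c v) T = c"
    proof (intro ballI ext)
      fix c v assume "c \<in> colorings_on E T m"
      then show "restrict (\<lambda>v. if v \<in> U - T then Suc m else c v) T v = c v"
        by (auto simp: colorings_on_def PiE_iff extensional_def)
    qed
    show "(\<lambda>c. restrict c T) ` {c \<in> colorings_on E U (Suc m). {v \<in> U. c v \<le> m} = T}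
        \<subseteq> colorings_on E T m"
      using assms by (auto simp: colorings_on_def PiE_iff)
    show "(\<lambda>c v. if v \<in> U - T then Suc m else c v) ` colorings_on E T m
        \<subseteq> {c \<in> colorings_on E U (Suc m). {v \<in> U. c v \<le> m} = T}"
    proof (intro image_subsetI)
      fix c assume c: "c \<in> colorings_on E T m"
      have cm: "c v \<in> {1..m}" if "v \<in> T" for v
        using c that by (auto simp: colorings_on_def PiE_iff)
      let ?c = "\<lambda>v. if v \<in> U - T then Suc m else c v"
      have "?c \<in> U \<rightarrow>\<^sub>E {1..Suc m}"
        using c cm assms by (force simp: colorings_on_def PiE_iff extensional_def)
      moreover have "?c a \<noteq> ?c b" if "a \<in> U" "b \<in> U" "E a b" for a b
        using that c False cm[of a] cm[of b] by (auto simp: colorings_on_def)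
      moreover have "{v \<in> U. ?c v \<le> m} = T"
        using assms cm by auto
      ultimately show "?c \<in> {c \<in> colorings_on E U (Suc m). {v \<in> U. c v \<le> m} = T}"
        by (simp add: colorings_on_def)
    qed
  qed
  then show ?thesis
    using False by (simp add: bij_betw_same_card indep_def)
qed

text \<open>One more color means one more convolution with \<open>indep E\<close>, the exponential
  of \<open>ursell E\<close>. In the exponent this adds one more copy of
  \<open>ursell E\<close>.\<close>

lemma card_colorings_on:
  assumes "finite U"
  shows "real (card (colorings_on E U m)) = setexp (\<lambda>S. real m * ursell E S) U"
  using assms
proof (induction m arbitrary: U)
  case 0
  have "colorings_on E U 0 = (if U = {} then {\<lambda>_. undefined} else {})"
    by (auto simp: colorings_on_def)
  with 0 show ?case by (simp add: setexp_zero)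
next
  case (Suc m)
  have "real (card (colorings_on E U (Suc m))) =
      (\<Sum>T\<in>Pow U. real (card {c \<in> colorings_on E U (Suc m). {v \<in> U. c v \<le> m} = T}))"
    using sum.group[of "colorings_on E U (Suc m)" "Pow U" "\<lambda>c. {v \<in> U. c v \<le> m}" "\<lambda>_. 1::real"]
      Suc.prems finite_colorings_on[OF Suc.prems, of E "Suc m"]
    by (simp add: image_subset_iff)
  also have "\<dots> =
      (\<Sum>T\<in>Pow U. real (card (colorings_on E T m)) * indep E (U - T))"
    by (simp add: card_colorings_on_last_class)
  also have "\<dots> = (\<Sum>T\<in>Pow U. setexp (\<lambda>S. real m * ursell E S) T * setexp (ursell E) (U - T))"
    using Suc.prems
    by (intro sum.cong refl arg_cong2[where f = "(*)"] Suc.IH setexp_ursell[symmetric])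
       (auto intro: finite_subset)
  also have "\<dots> = setexp (\<lambda>S. real m * ursell E S + ursell E S) U"
    using Suc.prems by (simp add: setexp_add)
  also have "(\<lambda>S. real m * ursell E S + ursell E S) = (\<lambda>S. real (Suc m) * ursell E S)"
    by (auto simp: algebra_simps)
  finally show ?case .
qed

section \<open>Bounds on the Ursell function\<close>

lemma sum_UN_le:
  fixes h :: "'b \<Rightarrow> real"
  assumes "finite I" "\<And>i. i \<in> I \<Longrightarrow> finite (A i)" "\<And>x. h x \<ge> 0"
  shows "sum h (\<Union>i\<in>I. A i) \<le> (\<Sum>i\<in>I. sum h (A i))"
  using assms(1,2)
proof (induction rule: finite_induct)
  case (insert i I)
  have "sum h (A i \<union> (\<Union>i\<in>I. A i)) + sum h (A i \<inter> (\<Union>i\<in>I. A i)) = sum h (A i) + sum h (\<Union>i\<in>I. A i)"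
    using insert by (intro sum.union_inter) auto
  moreover have "sum h (A i \<inter> (\<Union>i\<in>I. A i)) \<ge> 0"
    by (intro sum_nonneg assms)
  moreover have "sum h (\<Union>i\<in>I. A i) \<le> (\<Sum>i\<in>I. sum h (A i))"
    using insert by auto
  ultimately show ?case using insert.hyps by simp
qed simp

text \<open>The inequality for \<open>b\<close> is what closes the induction. Each block in the
  recursion for \<open>u\<close> contains one of at most \<open>d\<close> neighbours
  \<open>v\<close>; the sets containing \<open>v\<close> contribute at most \<open>z * b\<close>,
  with the factor \<open>z\<close> for \<open>v\<close> itself and \<open>b\<close> from the
  induction hypothesis for \<open>V - {v}\<close>.\<close>

lemma ursell_sum_le:
  fixes z b :: real
  assumes E: "symp E" "irreflp E"
    and deg: "\<And>u. u \<in> W \<Longrightarrow> card (W \<inter> {v. E u v}) \<le> d"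
    and z: "z \<ge> 0" and b: "exp (real d * z * b) \<le> b"
    and "finite W" "insert u V \<subseteq> W" "u \<notin> V"
  shows "(\<Sum>S\<in>Pow V. \<bar>ursell E (insert u S)\<bar> * z ^ card S) \<le> b"
proof -
  have "finite V" using \<open>insert u V \<subseteq> W\<close> \<open>finite W\<close> by (auto intro: finite_subset)
  then show ?thesis using assms(7,8)
  proof (induction arbitrary: u rule: finite_psubset_induct)
    case (psubset V)
    let ?N = "{v. E u v}"
    define g where "g = (\<lambda>C. z ^ card C * (if C \<inter> ?N = {} then 0 else \<bar>ursell E C\<bar>))"
    have g_nn: "g C \<ge> 0" for C using z by (simp add: g_def)
    have b0: "b \<ge> 0" using b exp_ge_zero order_trans by blast
    have "(\<Sum>S\<in>Pow V. \<bar>ursell E (insert u S)\<bar> * z ^ card S) \<le> (\<Sum>S\<in>Pow V. setexp g S)"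
    proof (intro sum_mono)
      fix S assume "S \<in> Pow V"
      then have S: "finite S" "u \<notin> S" using psubset by (auto intro: finite_subset)
      have "\<bar>ursell E (insert u S)\<bar> \<le> setexp (\<lambda>C. \<bar>if C \<inter> ?N = {} then 0 else - ursell E C\<bar>) S"
        unfolding ursell_insert[OF E S] by (rule abs_setexp_le) fact
      also have "(\<lambda>C. \<bar>if C \<inter> ?N = {} then 0 else - ursell E C\<bar>) =
          (\<lambda>C. if C \<inter> ?N = {} then 0 else \<bar>ursell E C\<bar>)" by auto
      finally have "z ^ card S * \<bar>ursell E (insert u S)\<bar> \<le> setexp g S"
        unfolding g_def setexp_scale[OF S(1), symmetric] using z by (intro mult_left_mono) auto
      then show "\<bar>ursell E (insert u S)\<bar> * z ^ card S \<le> setexp g S" by (simp add: mult.commute)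
    qed
    also have "\<dots> \<le> exp (\<Sum>C\<in>Pow V - {{}}. g C)"
      by (rule sum_setexp_le_exp) (use psubset g_nn in auto)
    also have "(\<Sum>C\<in>Pow V - {{}}. g C) \<le> real d * z * b"
    proof -
      have finN: "finite (V \<inter> ?N)" using psubset.hyps by auto
      have "(\<Sum>C\<in>Pow V - {{}}. g C) = (\<Sum>C | C \<in> Pow V \<and> C \<inter> ?N \<noteq> {}. z ^ card C * \<bar>ursell E C\<bar>)"
        using psubset.hyps by (intro sum.mono_neutral_cong_right) (auto simp: g_def)
      \<comment> \<open>Union bound: a set meeting the neighbourhood is counted once for each
        neighbour that it contains.\<close>
      also have "{C. C \<in> Pow V \<and> C \<inter> ?N \<noteq> {}} = (\<Union>v\<in>V \<inter> ?N. {C. C \<subseteq> V \<and> v \<in> C})"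
        by auto
      also have "(\<Sum>C\<in>\<dots>. z ^ card C * \<bar>ursell E C\<bar>) \<le>
          (\<Sum>v\<in>V \<inter> ?N. \<Sum>C | C \<subseteq> V \<and> v \<in> C. z ^ card C * \<bar>ursell E C\<bar>)"
        using finN psubset.hyps z by (intro sum_UN_le) auto
      also have "\<dots> \<le> (\<Sum>v\<in>V \<inter> ?N. z * b)"
      proof (intro sum_mono)
        fix v assume "v \<in> V \<inter> ?N"
        then have v: "v \<in> V" by auto
        have "(\<Sum>C | C \<subseteq> V \<and> v \<in> C. z ^ card C * \<bar>ursell E C\<bar>) =
            (\<Sum>S\<in>Pow (V - {v}). z * (\<bar>ursell E (insert v S)\<bar> * z ^ card S))"
        proof (rule sum.reindex_bij_witness[where i = "insert v" and j = "\<lambda>S. S - {v}"])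
          fix C assume C: "C \<in> {C. C \<subseteq> V \<and> v \<in> C}"
          then have "finite C" using psubset.hyps by (auto intro: finite_subset)
          with C have card: "card C = Suc (card (C - {v}))" by (intro card.remove) auto
          have "z ^ card C = z * z ^ card (C - {v})" unfolding card by simp
          with C show "z * (\<bar>ursell E (insert v (C - {v}))\<bar> * z ^ card (C - {v})) =
              z ^ card C * \<bar>ursell E C\<bar>"
            by (simp add: insert_absorb mult_ac)
        qed (use v in auto)
        also have "\<dots> = z * (\<Sum>S\<in>Pow (V - {v}). \<bar>ursell E (insert v S)\<bar> * z ^ card S)"
          by (simp add: sum_distrib_left)
        also have "\<dots> \<le> z * b"
          using z v psubset.prems by (intro mult_left_mono psubset.IH) auto
        finally show "(\<Sum>C | C \<subseteq> V \<and> v \<in> C. z ^ card C * \<bar>ursell E C\<bar>) \<le> z * b" .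
      qed
      also have "\<dots> = real (card (V \<inter> ?N)) * (z * b)" by simp
      also have "\<dots> \<le> real d * (z * b)"
      proof -
        have "card (V \<inter> ?N) \<le> card (W \<inter> ?N)"
          using psubset.prems \<open>finite W\<close> by (intro card_mono) auto
        also have "\<dots> \<le> d" using psubset.prems by (intro deg) auto
        finally show ?thesis using z b0 by (intro mult_right_mono) auto
      qed
      finally show ?thesis by (simp add: mult.assoc)
    qed
    then have "exp (\<Sum>C\<in>Pow V - {{}}. g C) \<le> exp (real d * z * b)" by simp
    also note b
    finally show ?case .
  qed
qed

section \<open>The zero-free region and the sign on the negative axis\<close>

lemma exp_two_fifths: "exp (2 / 5 :: real) \<le> 3 / 2"
\<comment> \<open>With \<open>n = 4\<close> the rule compares fifth powers: 2.72 squared is 7.3984,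
  below 7.59375, the fifth power of 3/2.\<close>
proof (rule power_le_imp_le_base[where n = 4])
  have "exp (2 / 5 :: real) ^ Suc 4 = exp 1 ^ 2"
    by (simp flip: exp_of_nat_mult)
  also have "\<dots> \<le> (272 / 100) ^ 2"
    using e_less_272 by (intro power_mono) auto
  also have "\<dots> \<le> (3 / 2) ^ Suc 4" by (simp add: eval_nat_numeral)
  finally show "exp (2 / 5 :: real) ^ Suc 4 \<le> (3 / 2) ^ Suc 4" .
qed simp

text \<open>The block \<open>{u}\<close> contributes \<open>x * P U\<close>, and the other blocks
  are a small perturbation. A general normed field covers both complex \<open>x\<close>, to exclude
  zeros, and real \<open>x\<close>, to determine the sign.\<close>

lemma setexp_ursell_ratio:
  fixes x :: "'r::real_normed_field"
  assumes E: "symp E" "irreflp E"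
    and deg: "\<And>u. u \<in> W \<Longrightarrow> card (W \<inter> {v. E u v}) \<le> d"
    and x: "x \<noteq> 0" "norm x \<ge> 15 / 2 * real d"
    and "finite W" "insert u U \<subseteq> W" "u \<notin> U"
  defines "P \<equiv> setexp (\<lambda>S. x * of_real (ursell E S))"
  shows "norm (P (insert u U) - x * P U) \<le> norm (x * P U) / 2"
proof -
  have "finite U" using \<open>insert u U \<subseteq> W\<close> \<open>finite W\<close> by (auto intro: finite_subset)
  then show ?thesis using \<open>insert u U \<subseteq> W\<close> \<open>u \<notin> U\<close>
  proof (induction arbitrary: u rule: finite_psubset_induct)
    case (psubset U)
    \<comment> \<open>A deviation of at most one half gives
      \<open>norm (P (insert v T)) \<ge> norm (x * P T) / 2\<close>, so removing a vertex costs a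
      factor of at most \<open>z\<close>.\<close>
    define z where "z = 2 / norm x"
    have z: "z \<ge> 0" "z * norm x = 2" using x by (auto simp: z_def)
    \<comment> \<open>The left side is \<open>3 * d / norm x\<close>, which accounts for the
      constant 15/2.\<close>
    have "real d * z * (3 / 2) \<le> 2 / 5" using x by (simp add: z_def field_simps)
    then have "exp (real d * z * (3 / 2)) \<le> exp (2 / 5)" by simp
    also note exp_two_fifths
    finally have b: "exp (real d * z * (3 / 2)) \<le> 3 / 2" .
    have step: "norm (P T) \<le> z * norm (P (insert v T))" if "insert v T \<subseteq> U" "v \<notin> T" for v T
    proof -
      have "norm (P (insert v T) - x * P T) \<le> norm (x * P T) / 2"
        using that psubset.prems by (intro psubset.IH) auto
      moreover have "norm (x * P T) - norm (P (insert v T)) \<le> norm (P (insert v T) - x * P T)"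
        by (metis norm_minus_commute norm_triangle_ineq2)
      ultimately have "norm x * norm (P T) \<le> 2 * norm (P (insert v T))"
        by (simp add: norm_mult)
      then show ?thesis using x by (simp add: z_def field_simps)
    qed
    have steps: "norm (P (U - S)) \<le> z ^ card S * norm (P U)" if "S \<subseteq> U" for S
    proof -
      have "finite S" using that psubset.hyps finite_subset by blast
      then show ?thesis using that
      proof (induction rule: finite_induct)
        case (insert v S)
        have eq: "insert v (U - insert v S) = U - S" using insert by auto
        have "norm (P (U - insert v S)) \<le> z * norm (P (U - S))"
          using step[of v "U - insert v S"] insert unfolding eq by auto
        also have "\<dots> \<le> z * (z ^ card S * norm (P U))"
          using insert z by (intro mult_left_mono) auto
        finally show ?case using insert by (simp add: mult.assoc)
      qed simp
    qed
    have finP: "finite (Pow U)" using psubset.hyps by simp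
    have u1: "ursell E {u} = 1" using E by (intro ursell_singleton) (auto dest: irreflpD)
    have rm: "sum h (Pow U) = h {} + sum h (Pow U - {{}})" for h :: "_ \<Rightarrow> 's::comm_monoid_add"
      using finP by (intro sum.remove) auto
    have "P (insert u U) = (\<Sum>S\<in>Pow U. x * of_real (ursell E (insert u S)) * P (U - S))"
      unfolding P_def using psubset by (intro setexp_rec_insert) auto
    also have "\<dots> = x * P U + (\<Sum>S\<in>Pow U - {{}}. x * of_real (ursell E (insert u S)) * P (U - S))"
      by (subst rm) (simp add: u1)
    finally have "norm (P (insert u U) - x * P U) =
        norm (\<Sum>S\<in>Pow U - {{}}. x * of_real (ursell E (insert u S)) * P (U - S))" by simp
    also have "\<dots> \<le> (\<Sum>S\<in>Pow U - {{}}. norm (x * P U) * (\<bar>ursell E (insert u S)\<bar> * z ^ card S))"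
    proof (rule sum_norm_le)
      fix S assume "S \<in> Pow U - {{}}"
      then have "norm x * \<bar>ursell E (insert u S)\<bar> * norm (P (U - S)) \<le>
          norm x * \<bar>ursell E (insert u S)\<bar> * (z ^ card S * norm (P U))"
        by (intro mult_left_mono steps) auto
      then show "norm (x * of_real (ursell E (insert u S)) * P (U - S)) \<le>
          norm (x * P U) * (\<bar>ursell E (insert u S)\<bar> * z ^ card S)"
        by (simp add: norm_mult mult_ac)
    qed
    also have "\<dots> = norm (x * P U) * (\<Sum>S\<in>Pow U - {{}}. \<bar>ursell E (insert u S)\<bar> * z ^ card S)"
      by (simp add: sum_distrib_left)
    also have "\<dots> \<le> norm (x * P U) * (1 / 2)"
    proof (intro mult_left_mono)
      \<comment> \<open>The term for \<open>S = {}\<close> equals 1, so at most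
        \<open>3/2 - 1\<close> is left for the others.\<close>
      have "(\<Sum>S\<in>Pow U. \<bar>ursell E (insert u S)\<bar> * z ^ card S) \<le> 3 / 2"
        by (rule ursell_sum_le[OF E deg z(1) b \<open>finite W\<close> psubset.prems])
      then show "(\<Sum>S\<in>Pow U - {{}}. \<bar>ursell E (insert u S)\<bar> * z ^ card S) \<le> 1 / 2"
        by (simp add: rm u1)
    qed simp
    finally show ?case by simp
  qed
qed

lemma setexp_ursell_nonzero:
  fixes x :: "'r::real_normed_field"
  assumes E: "symp E" "irreflp E"
    and deg: "\<And>u. u \<in> W \<Longrightarrow> card (W \<inter> {v. E u v}) \<le> d"
    and x: "x \<noteq> 0" "norm x \<ge> 15 / 2 * real d" and W: "finite W"
  shows "setexp (\<lambda>S. x * of_real (ursell E S)) W \<noteq> 0"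
proof -
  let ?P = "setexp (\<lambda>S. x * of_real (ursell E S))"
  have "?P U \<noteq> 0" if "finite U" "U \<subseteq> W" for U
    using that
  proof (induction rule: finite_induct)
    case (insert u U)
    have "norm (?P (insert u U) - x * ?P U) \<le> norm (x * ?P U) / 2"
      by (rule setexp_ursell_ratio[OF E deg x W insert.prems insert.hyps(2)])
    moreover have "norm (x * ?P U) > 0" using insert x by simp
    ultimately show ?case by auto
  qed simp
  with W show ?thesis by blast
qed

text \<open>A real number within 1/2 of 1 is positive, so each added vertex multiplies the value by
  a number with the sign of \<open>x\<close>.\<close>

lemma setexp_ursell_sign:
  fixes x :: real
  assumes E: "symp E" "irreflp E"
    and deg: "\<And>u. u \<in> W \<Longrightarrow> card (W \<inter> {v. E u v}) \<le> d"
    and x: "x < 0" "- x \<ge> 15 / 2 * real d" and W: "finite W"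
  shows "(- 1) ^ card W * setexp (\<lambda>S. x * ursell E S) W > 0"
proof -
  let ?P = "setexp (\<lambda>S. x * ursell E S)"
  have "(- 1) ^ card U * ?P U > 0" if "finite U" "U \<subseteq> W" for U
    using that
  proof (induction rule: finite_induct)
    case (insert u U)
    define a where "a = (- 1) ^ card U * ?P U"
    have a: "a > 0" using insert by (simp add: a_def)
    have "\<bar>?P (insert u U) - x * ?P U\<bar> \<le> \<bar>x * ?P U\<bar> / 2"
      using setexp_ursell_ratio[OF E deg _ _ W insert.prems insert.hyps(2), of x] x by simp
    then have "\<bar>(- 1) ^ card U * (?P (insert u U) - x * ?P U)\<bar> \<le> \<bar>(- 1) ^ card U * (x * ?P U)\<bar> / 2"
      by (simp add: abs_mult)
    then have "\<bar>(- 1) ^ card U * ?P (insert u U) - x * a\<bar> \<le> \<bar>x * a\<bar> / 2"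
      by (simp add: a_def algebra_simps)
    moreover have "x * a < 0" using a x by (simp add: mult_neg_pos)
    ultimately have "(- 1) ^ card U * ?P (insert u U) < 0" by linarith
    then show ?case using insert.hyps by simp
  qed simp
  with W show ?thesis by blast
qed

section \<open>Derivatives of the logarithm of a polynomial\<close>

text \<open>For \<open>0 < t \<le> 1\<close> the cubic Taylor bound gives
  \<open>sin t \<ge> 5/6 * t\<close>, and \<open>pi \<ge> 3\<close> turns this into the rational
  constant 5/4.\<close>

lemma sin_pi_div_ge:
  assumes "k \<ge> 2"
  shows "sin (pi / (2 * real k)) \<ge> 5 / 4 / real k"
proof -
  \<comment> \<open>This compares \<open>sin (pi / 6) = 1/2\<close> with
    \<open>pi / 6\<close>.\<close>
  have pi3: "pi \<ge> 3" using sin_x_le_x[of "pi / 6"] by (simp add: sin_30)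
  define t where "t = pi / (2 * real k)"
  have t0: "t > 0" using assms by (simp add: t_def)
  have t1: "t \<le> 1" using assms pi_less_4 by (simp add: t_def field_simps)
  have "t ^ 3 = t * t ^ 2" by (simp add: eval_nat_numeral)
  also have "\<dots> \<le> t * 1" using t0 t1 by (intro mult_left_mono power_le_one) auto
  finally have "t ^ 3 \<le> t" by simp
  moreover have "\<bar>sin t - t\<bar> \<le> t ^ 3 / 6"
    using Maclaurin_sin_bound[of t 3] t0 by (simp add: eval_nat_numeral sin_coeff_def)
  ultimately have "sin t \<ge> t * (5 / 6)" by linarith
  moreover have "t * (5 / 6) \<ge> 5 / 4 / real k"
    using assms pi3 by (simp add: t_def field_simps)
  ultimately show ?thesis unfolding t_def by linarith
qed

text \<open>\<open>1 + t\<close> lies in a disc about 1 of radius less than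
  \<open>sin (pi / (2 * k))\<close>. Seen from 0 this disc stays within the angle
  \<open>pi / (2 * k)\<close>, so the \<open>k\<close>-th power remains in the right
  half-plane.\<close>

lemma Re_inverse_power_pos:
  fixes t :: complex
  assumes k: "k \<ge> 2" and t: "norm t * real k < 5 / 4"
  shows "Re (inverse ((1 + t) ^ k)) > 0"
proof -
  define w where "w = 1 + t"
  have tk: "norm t < 5 / 4 / real k" using t k by (simp add: field_simps)
  also have "\<dots> < 1" using k by (simp add: field_simps)
  finally have t1: "norm t < 1" .
  have Re: "Re w > 0" using abs_Re_le_cmod[of t] t1 by (simp add: w_def)
  then have w0: "w \<noteq> 0" by auto
  have arg: "\<bar>Arg w\<bar> < pi / 2" using Re unfolding Arg_Re_pos by simp
  \<comment> \<open>The line through 0 and \<open>w\<close> has distance \<open>\<bar>sin (Arg w)\<bar>\<close> from 1.\<close>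
  have "\<bar>Im w\<bar> = \<bar>Im (w * cnj (w - 1))\<bar>" by (simp add: algebra_simps)
  also have "\<dots> \<le> norm w * norm t"
    using abs_Im_le_cmod[of "w * cnj (w - 1)"] by (simp add: norm_mult w_def)
  finally have "norm w * \<bar>sin (Arg w)\<bar> \<le> norm w * norm t"
    using arg_cong[OF rcis_cmod_Arg[of w], of Im] by (simp add: rcis_def abs_mult flip: abs_mult)
  then have "\<bar>sin (Arg w)\<bar> \<le> norm t" using w0 by simp
  also have "\<dots> < sin (pi / (2 * real k))" using tk sin_pi_div_ge[OF k] by linarith
  finally have sin: "sin \<bar>Arg w\<bar> < sin (pi / (2 * real k))" by (auto simp: abs_if split: if_splits)
  \<comment> \<open>Both angles lie in \<open>[- pi / 2, pi / 2]\<close>, where the sine is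
    increasing.\<close>
  have "\<bar>Arg w\<bar> < pi / (2 * real k)"
  proof (rule ccontr)
    assume "\<not> \<bar>Arg w\<bar> < pi / (2 * real k)"
    moreover have "- (pi / 2) \<le> 0" "0 \<le> pi / (2 * real k)" by simp_all
    ultimately have "sin (pi / (2 * real k)) \<le> sin \<bar>Arg w\<bar>"
      using arg by (intro sin_monotone_2pi_le) linarith+
    with sin show False by simp
  qed
  then have "\<bar>real k * Arg w\<bar> < pi / 2" using k by (simp add: abs_mult field_simps)
  then have "cos (real k * Arg w) > 0" by (intro cos_gt_zero_pi) linarith+
  moreover have "w ^ k = rcis (norm w ^ k) (real k * Arg w)"
    by (metis DeMoivre2 rcis_cmod_Arg)
  ultimately have "Re (w ^ k) > 0" using w0 by simp
  moreover have "Re (inverse z) > 0" if "Re z > 0" for z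
    using that by (simp add: add_pos_nonneg)
  ultimately show ?thesis unfolding w_def by blast
qed

lemma has_real_derivative_Re_of_real:
  assumes "(F has_field_derivative D) (at (complex_of_real y))"
  shows "((\<lambda>y. Re (F (complex_of_real y))) has_real_derivative Re D) (at y)"
  using assms by (intro has_field_derivative_Re has_vector_derivative_real_field)

text \<open>For \<open>y < - R\<close> every \<open>root i - y\<close> is in the right half-plane,
  where the principal \<open>Ln\<close> is holomorphic with real part \<open>ln\<close> of the norm.
  The values of \<open>f\<close> on this open half-line determine all its derivatives there.\<close>

lemma higher_deriv_ln_poly:
  fixes root :: "nat \<Rightarrow> complex"
  assumes p: "p = smult c (\<Prod>i<n. [:- root i, 1:])" and c: "c \<noteq> 0"
    and root: "\<And>i. i < n \<Longrightarrow> norm (root i) \<le> R"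
    and f: "\<And>y. y < - R \<Longrightarrow> f y = ln (norm (poly p (complex_of_real y)))"
    and "y < - R"
  shows "(deriv ^^ Suc j) f y =
    - fact j * (\<Sum>i<n. Re (inverse ((root i - complex_of_real y) ^ Suc j)))"
proof -
  have Re: "Re (root i - complex_of_real y) > 0" if "i < n" "y < - R" for i y
    using that root[of i] abs_Re_le_cmod[of "root i"] by auto
  then have nz: "root i - complex_of_real y \<noteq> 0" if "i < n" "y < - R" for i y
    using that by (metis less_irrefl zero_complex.sel(1))
  have deriv_eq: "deriv g y = Re D"
    if y: "y < - R" and g: "\<And>y. y < - R \<Longrightarrow> g y = Re (F (complex_of_real y))"
      and F: "(F has_field_derivative D) (at (complex_of_real y))" for g F D y
  proof -
    have "(g has_real_derivative Re D) (at y)"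
      by (rule has_field_derivative_transform_within_open
           [OF has_real_derivative_Re_of_real[OF F], of "{..< - R}"])
         (use y g in auto)
    then show ?thesis by (rule DERIV_imp_deriv)
  qed
  have f': "f y = Re (complex_of_real (ln (norm c)) + (\<Sum>i<n. Ln (root i - complex_of_real y)))"
    if "y < - R" for y
  proof -
    have "norm (poly p (complex_of_real y)) = norm c * (\<Prod>i<n. norm (root i - complex_of_real y))"
      by (simp add: p poly_prod norm_mult norm_power flip: prod_norm) (simp add: norm_minus_commute)
    also have "ln \<dots> = ln (norm c) + (\<Sum>i<n. ln (norm (root i - complex_of_real y)))"
      using c nz[OF _ that] by (subst ln_mult, auto intro!: prod_pos) (subst ln_prod, auto)
    also have "(\<Sum>i<n. ln (norm (root i - complex_of_real y))) = 
        (\<Sum>i<n. Re (Ln (root i - complex_of_real y)))"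
      using nz[OF _ that] by (intro sum.cong) auto
    finally show ?thesis using f[OF that] by simp
  qed
  show ?thesis using \<open>y < - R\<close>
  proof (induction j arbitrary: y)
    case 0
    have "((\<lambda>z. complex_of_real (ln (norm c)) + (\<Sum>i<n. Ln (root i - z)))
        has_field_derivative (\<Sum>i<n. - inverse (root i - complex_of_real y))) (at (complex_of_real y))"
    proof -
      have "root i - complex_of_real y \<notin> \<real>\<^sub>\<le>\<^sub>0" if "i < n" for i
        using Re[OF that 0] by (auto simp: complex_nonpos_Reals_iff)
      then show ?thesis
        by (auto intro!: derivative_eq_intros sum.cong simp: divide_inverse)
    qed
    from deriv_eq[OF 0 f' this] show ?case by (simp add: sum_negf)
  next
    case (Suc j)
    \<comment> \<open>The inner derivative of \<open>root i - z\<close> is -1 and cancels the sign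
      of the negative exponent, so no alternating sign appears.\<close>
    have "((\<lambda>z. - fact j * (\<Sum>i<n. inverse ((root i - z) ^ Suc j)))
        has_field_derivative - fact (Suc j) * (\<Sum>i<n. inverse ((root i - complex_of_real y) ^ Suc (Suc j))))
        (at (complex_of_real y))"
    proof -
      have "((\<lambda>z. inverse ((root i - z) ^ Suc j)) has_field_derivative
          of_nat (Suc j) * inverse ((root i - complex_of_real y) ^ Suc (Suc j))) (at (complex_of_real y))"
        if "i < n" for i
      proof -
        have "((\<lambda>z. inverse (root i - z)) has_field_derivative
            inverse (root i - complex_of_real y) * inverse (root i - complex_of_real y))
            (at (complex_of_real y))"
          using nz[OF that Suc.prems] by (auto intro!: derivative_eq_intros)
        from DERIV_power_Suc[OF this, of j] show ?thesis
          by (simp add: power_inverse mult_ac)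
      qed
      then have "((\<lambda>z. - fact j * (\<Sum>i<n. inverse ((root i - z) ^ Suc j))) has_field_derivative
          - fact j * (\<Sum>i<n. of_nat (Suc j) * inverse ((root i - complex_of_real y) ^ Suc (Suc j))))
          (at (complex_of_real y))"
        by (intro DERIV_cmult DERIV_sum) auto
      then show ?thesis by (simp add: sum_distrib_left mult_ac)
    qed
    from deriv_eq[OF Suc.prems _ this, of "(deriv ^^ Suc j) f"] Suc.IH
    show ?case by simp
  qed
qed

section \<open>The chromatic polynomial\<close>

lemma poly_setexp:
  assumes "finite U"
  shows "poly (setexp (\<lambda>S. [:0, f S:]) U) x = setexp (\<lambda>S. x * f S) U"
  using setexp_homomorphism[OF assms, of "\<lambda>p. poly p x" "\<lambda>S. [:0, f S:]"] by simp

lemma proper_colorings_eq_colorings_on: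
  assumes "wf_digraph G"
  shows "proper_colorings G m = colorings_on (\<lambda>u v. (u, v) \<in> arcs_ends G) (verts G) m"
proof -
  interpret wf_digraph G by fact
  have "(\<forall>e\<in>arcs G. c (tail G e) \<noteq> c (head G e)) \<longleftrightarrow>
      (\<forall>a\<in>verts G. \<forall>b\<in>verts G. (a, b) \<in> arcs_ends G \<longrightarrow> c a \<noteq> c b)" for c :: "'a \<Rightarrow> nat"
    unfolding arcs_ends_conv by (auto 4 4)
  then show ?thesis by (simp add: proper_colorings_def colorings_on_def)
qed

text \<open>Both polynomials count the proper colorings at every positive integer, which determines
  them.\<close>

lemma chromatic_poly_eq_setexp:
  assumes wf: "wf_digraph G" and fin: "finite (verts G)"
  shows "chromatic_poly G = setexp (\<lambda>S. [:0, ursell (\<lambda>u v. (u, v) \<in> arcs_ends G) S:]) (verts G)"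
  unfolding chromatic_poly_def
  by (rule the1_equality[OF chromatic_poly_ex1[OF wf fin]])
     (simp add: poly_setexp[OF fin] proper_colorings_eq_colorings_on[OF wf] card_colorings_on[OF fin])

lemma card_neighbours_le_max_degree:
  assumes "fin_digraph G" "u \<in> verts G"
  shows "card (verts G \<inter> {v. (u, v) \<in> arcs_ends G}) \<le> max_degree G"
proof -
  interpret fin_digraph G by fact
  have "verts G \<inter> {v. (u, v) \<in> arcs_ends G} \<subseteq> head G ` out_arcs G u"
    by (auto simp: arcs_ends_conv out_arcs_def)
  then have "card (verts G \<inter> {v. (u, v) \<in> arcs_ends G}) \<le> card (out_arcs G u)"
    by (rule surj_card_le[rotated]) (simp add: out_arcs_def)
  also have "\<dots> \<le> max_degree G"
    unfolding max_degree_def out_degree_def using assms(2) by (intro Max_ge) auto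
  finally show ?thesis .
qed

theorem theorem2p5:
  fixes G :: "('a, 'b) pre_digraph" and k :: nat and x :: real
  assumes "graph G"
    and "Digraph_Component.connected G"
    and "k \<ge> 2"
    and "x < 0"
    and "x \<le> - 6.66 * real (max_degree G) * real k"
  shows "(deriv ^^ k) (\<lambda>y::real. ln ((-1) ^ card (verts G) * poly (chromatic_poly G) y)) x < 0"
proof -
  interpret graph G by fact
  define E where "E = (\<lambda>u v. (u, v) \<in> arcs_ends G)"
  define V where "V = verts G"
  define d where "d = max_degree G"
  define R where "R = 15 / 2 * real d"
  \<comment> \<open>The chromatic polynomial with complex coefficients, so that it splits into
    linear factors.\<close>
  define p where "p = setexp (\<lambda>S. [:0, complex_of_real (ursell E S):]) V"
  have fin: "finite V" by (simp add: V_def)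
  have E: "symp E" "irreflp E"
    using sym_arcs by (auto simp: E_def symp_def irreflp_def symmetric_def sym_def dest: adj_not_same)
  have deg: "card (V \<inter> {v. E u v}) \<le> d" if "u \<in> V" for u
    using that card_neighbours_le_max_degree[OF fin_digraph_axioms, of u]
    by (simp add: V_def E_def d_def)
  have chrom: "chromatic_poly G = setexp (\<lambda>S. [:0, ursell E S:]) V"
    unfolding E_def V_def by (rule chromatic_poly_eq_setexp) (auto intro: wf_digraph_axioms)
  have poly_p: "poly p z = setexp (\<lambda>S. z * of_real (ursell E S)) V" for z
    unfolding p_def by (rule poly_setexp[OF fin])
  have of_real_poly: "complex_of_real (poly (chromatic_poly G) y) = poly p (of_real y)" for y
    unfolding chrom poly_setexp[OF fin] poly_p
    using setexp_homomorphism[OF fin, of complex_of_real "\<lambda>S. y * ursell E S"] by simp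
  have nonzero: "poly p z \<noteq> 0" if "z \<noteq> 0" "norm z \<ge> R" for z
    unfolding poly_p
    by (rule setexp_ursell_nonzero[OF E deg _ _ fin]) (use that in \<open>auto simp: R_def\<close>)
  have p0: "p \<noteq> 0"
  proof
    assume "p = 0"
    \<comment> \<open>The point is \<open>R + 1\<close> because \<open>R\<close> is 0 when
      \<open>d = 0\<close>.\<close>
    moreover have "poly p (of_real (R + 1)) \<noteq> 0"
    proof (rule nonzero)
      have "R + 1 > 0" by (simp add: R_def add_nonneg_pos)
      then show "complex_of_real (R + 1) \<noteq> 0" "norm (complex_of_real (R + 1)) \<ge> R"
        by (simp_all only: of_real_eq_0_iff norm_of_real)
    qed
    ultimately show False by simp
  qed
  obtain root where root: "smult (lead_coeff p) (\<Prod>i<degree p. [:- root i, 1:]) = p"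
    by (rule complex_poly_decompose')
  define n where "n = degree p"
  have root_le: "norm (root i) \<le> R" if "i < n" for i
  proof -
    have "poly p (root i) = 0"
      using that by (subst root[symmetric]) (auto simp: poly_prod n_def)
    then have "root i = 0 \<or> \<not> R \<le> norm (root i)" using nonzero by blast
    moreover have "R \<ge> 0" by (simp add: R_def)
    ultimately show ?thesis by auto
  qed
  \<comment> \<open>There must be a root for the final sum to be strictly positive. Since
    \<open>V\<close> is nonempty, 0 is one: all block weights vanish there.\<close>
  have "n > 0"
  proof (rule ccontr)
    assume "\<not> n > 0"
    then have "poly p 0 = lead_coeff p" by (simp add: n_def poly_0_coeff_0)
    moreover have "poly p 0 = 0"
    proof -
      have "V \<noteq> {}" using assms(2) by (auto simp: V_def connected_def strongly_connected_def)
      then show ?thesis using fin by (simp add: poly_p setexp_zero)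
    qed
    ultimately show False using p0 by simp
  qed
  have f: "ln ((-1) ^ card (verts G) * poly (chromatic_poly G) y) = ln (norm (poly p (complex_of_real y)))"
    if "y < - R" for y
  proof -
    have "R \<ge> 0" by (simp add: R_def)
    with that have y: "y < 0" "- y \<ge> 15 / 2 * real d" by (auto simp: R_def)
    have "0 < (-1) ^ card V * poly (chromatic_poly G) y"
      unfolding chrom poly_setexp[OF fin] by (rule setexp_ursell_sign[OF E deg y fin])
    then have "(-1) ^ card V * poly (chromatic_poly G) y = \<bar>(-1) ^ card V * poly (chromatic_poly G) y\<bar>"
      by simp
    also have "\<dots> = norm (poly p (complex_of_real y))"
      unfolding of_real_poly[symmetric] by (simp add: abs_mult)
    finally show ?thesis by (simp add: V_def)
  qed
  have dk: "333 / 50 * (real d * real k) \<le> - x" using assms(5) by (simp add: d_def)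
  \<comment> \<open>As \<open>k \<ge> 2\<close>, \<open>- x\<close> is at least
    \<open>13.32 * d\<close>, which exceeds \<open>7.5 * d\<close> unless \<open>d = 0\<close>; then
    \<open>x < 0\<close> suffices.\<close>
  have "real d * 2 \<le> real d * real k" using assms(3) by (intro mult_left_mono) auto
  with dk assms(4) have xR: "x < - R" unfolding R_def using of_nat_0_le_iff[of d] by linarith
  have pos: "Re (inverse ((root i - complex_of_real x) ^ k)) > 0" if "i < n" for i
  proof -
    \<comment> \<open>Dividing by the positive number \<open>- x\<close> turns
      \<open>root i - x\<close> into \<open>1 + t\<close>.\<close>
    define t where "t = root i / complex_of_real (- x)"
    have "norm (root i) * real k \<le> R * real k"
      using root_le[OF that] by (intro mult_right_mono) auto
    \<comment> \<open>\<open>5/4 * 6.66 = 8.325\<close> is larger than 15/2; for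
      \<open>d = 0\<close> strictness comes from \<open>x < 0\<close>.\<close>
    also have "\<dots> < 5 / 4 * - x" using dk assms(4) by (simp add: R_def)
    finally have "norm t * real k < 5 / 4"
      using assms(4) by (simp add: t_def norm_divide field_simps)
    then have "Re (inverse ((1 + t) ^ k)) > 0" by (rule Re_inverse_power_pos[OF assms(3)])
    moreover have "root i - complex_of_real x = of_real (- x) * (1 + t)"
      using assms(4) by (simp add: t_def field_simps)
    then have "inverse ((root i - complex_of_real x) ^ k) =
        of_real (inverse ((- x) ^ k)) * inverse ((1 + t) ^ k)"
      by (simp only: power_mult_distrib inverse_mult_distrib of_real_power of_real_inverse)
    then have "Re (inverse ((root i - complex_of_real x) ^ k)) =
        inverse ((- x) ^ k) * Re (inverse ((1 + t) ^ k))"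
      by (simp only: times_complex.sel Re_complex_of_real Im_complex_of_real mult_zero_left diff_zero)
    moreover have "inverse ((- x) ^ k) > 0" using assms(4) by simp
    ultimately show ?thesis by (simp only: mult_pos_pos)
  qed
  obtain j where k: "k = Suc j" using assms(3) by (cases k) auto
  have "(deriv ^^ k) (\<lambda>y::real. ln ((-1) ^ card (verts G) * poly (chromatic_poly G) y)) x =
      - fact j * (\<Sum>i<n. Re (inverse ((root i - complex_of_real x) ^ k)))"
    unfolding k
    by (rule higher_deriv_ln_poly[OF root[symmetric, folded n_def] _ root_le f xR])
       (use p0 in \<open>auto simp: n_def\<close>)
  also have "\<dots> < 0"
  proof (rule mult_neg_pos)
    show "(\<Sum>i<n. Re (inverse ((root i - complex_of_real x) ^ k))) > 0"
      by (rule sum_pos) (use \<open>n > 0\<close> pos in \<open>auto simp del: inverse_complex.sel\<close>)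
  qed simp
  finally show ?thesis .
qed

end
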